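(* Let $A,B,C,D\in\mathbb{C}$ be such that both hypergeometric series below terminate. Then $$ {}_{4}F_{3}\left(\begin{matrix}1,A,B,C\\(A+B+1)/2,\;D,\;1+2C-D\end{matrix}\right) ={}_{4}F_{3}\left(\begin{matrix}1,\;A/2,\;B/2,\;C\\(A+B+1)/2,\;(1+D)/2,\;1+C-D/2\end{matrix}\right). $$
   Context: ${}_pF_q$ denotes the generalized hypergeometric series evaluated at unit argument. Standing convention: lower parameters are never non-positive integers. A series terminates if one of its upper parameters is a non-positive integer. *)

theory Defs
  imports "HOL-Analysis.Analysis"
begin

definition hyp_at_one :: "complex list \<Rightarrow> complex list \<Rightarrow> complex" where
  "hyp_at_one us ls = eval_fps (fps_hypergeo us ls 1) 1"

definition hyp_admissible :: "complex list \<Rightarrow> bool" where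
  "hyp_admissible ls \<longleftrightarrow> (\<forall>b \<in> set ls. b \<notin> \<int>\<^sub>\<le>\<^sub>0)"

definition hyp_terminates :: "complex list \<Rightarrow> bool" where
  "hyp_terminates us \<longleftrightarrow> (\<exists>a \<in> set us. a \<in> \<int>\<^sub>\<le>\<^sub>0)"

text \<open>
  The third argument of \<^const>\<open>fps_hypergeo\<close> rescales the variable; with 1 the series is the
  usual one, whose term at the argument 1 is the following.
\<close>

lemma hyp_at_one_altdef:
  "hyp_at_one us ls =
     (\<Sum>n. (\<Prod>a\<leftarrow>us. pochhammer a n) / ((\<Prod>b\<leftarrow>ls. pochhammer b n) * fact n))"
proof -
  have *: "foldl (\<lambda>r a. r * pochhammer a n) x as = x * (\<Prod>a\<leftarrow>as. pochhammer a n)"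
    for as :: "complex list" and x n
    by (induction as arbitrary: x) (simp_all add: mult.assoc)
  show ?thesis
    by (simp add: hyp_at_one_def eval_fps_def *)
qed

end

theory Submission
  imports Defs
begin

text \<open>
  Put \<open>E = (A + B + 1) / 2\<close> and \<open>w = 4 x (1 - x)\<close>. Gauss' quadratic transformation
  \<open>F(A, B; E; x) = F(A/2, B/2; E; w)\<close> holds as an identity of power series in \<open>x\<close>, because both
  sides solve the same hypergeometric equation. Apply to it the linear functional \<open>L\<close> with
  \<open>L(x^n) = (1)\<^sub>n (C)\<^sub>n / ((D)\<^sub>n (1+2C-D)\<^sub>n)\<close>. Since the recurrence of these moments says that \<open>L\<close>
  annihilates \<open>x (1-x) g'' + C (1-2x) g' + (2C - D (1+2C-D)) g\<close> whenever \<open>g(0) = 0\<close>, and this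
  operator is symmetric under \<open>x \<mapsto> 1 - x\<close>, the choice \<open>g = w^k\<close> yields a first-order
  recurrence for \<open>L(w^k)\<close>, whence \<open>L(w^k) = (1)\<^sub>k (C)\<^sub>k / (((1+D)/2)\<^sub>k (1+C-D/2)\<^sub>k)\<close>.
\<close>

section \<open>The hypergeometric equation and its power series solution\<close>

text \<open>In degree n the terms with the n-th coefficient collect to n(n-1) + (a+b+1)n + ab =
  (a+n)(b+n), those with the next one to (n+1)(c+n).\<close>

lemma hypergeometric_ode_iff:
  fixes a b c :: "'a :: field_char_0" and f :: "'a fps"
  shows "fps_X * (1 - fps_X) * fps_deriv (fps_deriv f)
           + (fps_const c - fps_const (a + b + 1) * fps_X) * fps_deriv f = fps_const (a * b) * f
         \<longleftrightarrow> (\<forall>n. of_nat (Suc n) * (c + of_nat n) * fps_nth f (Suc n)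
                  = (a + of_nat n) * (b + of_nat n) * fps_nth f n)"
proof -
  let ?l = "fps_X * (1 - fps_X) * fps_deriv (fps_deriv f)
              + (fps_const c - fps_const (a + b + 1) * fps_X) * fps_deriv f"
  \<comment> \<open>Expanded so that each factor \<open>fps_X\<close> only shifts coefficients; the
    double shift is why degrees 0 and 1 are separate cases below.\<close>
  have split: "?l = fps_X * fps_deriv (fps_deriv f) - fps_X * (fps_X * fps_deriv (fps_deriv f))
      + fps_const c * fps_deriv f - fps_const (a + b + 1) * (fps_X * fps_deriv f)"
    by (simp add: algebra_simps)
  have "fps_nth ?l n = fps_nth (fps_const (a * b) * f) n \<longleftrightarrow>
      of_nat (Suc n) * (c + of_nat n) * fps_nth f (Suc n) =
        (a + of_nat n) * (b + of_nat n) * fps_nth f n" for n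
  proof -
    consider "n = 0" | "n = 1" | k where "n = Suc (Suc k)"
      by (metis One_nat_def not0_implies_Suc)
    then show ?thesis
      by cases (simp_all add: split, (simp_all add: algebra_simps)?)
  qed
  then show ?thesis
    unfolding fps_eq_iff by blast
qed

definition hyp2f1_fps :: "complex \<Rightarrow> complex \<Rightarrow> complex \<Rightarrow> complex fps" where
  "hyp2f1_fps a b c = Abs_fps (\<lambda>n. pochhammer a n * pochhammer b n / (pochhammer c n * fact n))"

lemma hyp2f1_fps_nth [simp]:
  "fps_nth (hyp2f1_fps a b c) n = pochhammer a n * pochhammer b n / (pochhammer c n * fact n)"
  by (simp add: hyp2f1_fps_def)

lemma pochhammer_nonzero:
  fixes c :: complex
  assumes "c \<notin> \<int>\<^sub>\<le>\<^sub>0"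
  shows "pochhammer c n \<noteq> 0" "c + of_nat n \<noteq> 0"
proof -
  show "c + of_nat n \<noteq> 0" for n
    using assms by (metis add_eq_0_iff2 minus_of_nat_in_nonpos_Ints)
  then show "pochhammer c n \<noteq> 0"
    by (auto simp: pochhammer_prod)
qed

lemma hyp2f1_fps_recurrence:
  assumes "c \<notin> \<int>\<^sub>\<le>\<^sub>0"
  shows "of_nat (Suc n) * (c + of_nat n) * fps_nth (hyp2f1_fps a b c) (Suc n)
       = (a + of_nat n) * (b + of_nat n) * fps_nth (hyp2f1_fps a b c) n"
proof -
  have "of_nat (Suc n) \<noteq> (0 :: complex)"
    using of_nat_neq_0 by blast
  with pochhammer_nonzero[OF assms, of n] show ?thesis
    by (simp add: pochhammer_Suc divide_simps del: of_nat_Suc)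
qed

text \<open>The leading factor of the recurrence never vanishes, so the constant term determines all
  coefficients.\<close>

lemma fps_eq_hyp2f1_fps:
  assumes "c \<notin> \<int>\<^sub>\<le>\<^sub>0" "fps_nth f 0 = 1"
    and "\<And>n. of_nat (Suc n) * (c + of_nat n) * fps_nth f (Suc n)
               = (a + of_nat n) * (b + of_nat n) * fps_nth f n"
  shows "f = hyp2f1_fps a b c"
proof (rule fps_ext)
  fix n
  show "fps_nth f n = fps_nth (hyp2f1_fps a b c) n"
  proof (induction n)
    case (Suc n)
    have "of_nat (Suc n) * (c + of_nat n) \<noteq> 0"
      using pochhammer_nonzero(2)[OF assms(1)] of_nat_neq_0 by (metis mult_eq_0_iff)
    moreover have "of_nat (Suc n) * (c + of_nat n) * fps_nth f (Suc n)
        = of_nat (Suc n) * (c + of_nat n) * fps_nth (hyp2f1_fps a b c) (Suc n)"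
      unfolding assms(3) hyp2f1_fps_recurrence[OF assms(1)] Suc.IH ..
    ultimately show ?case
      using mult_left_cancel by blast
  qed (use assms(2) in simp)
qed

section \<open>Gauss' quadratic transformation\<close>

definition quad :: "complex fps" where
  "quad = 4 * fps_X * (1 - fps_X)"

lemma quad_nth_0 [simp]: "fps_nth quad 0 = 0"
  by (simp add: quad_def)

lemma fps_deriv_quad: "fps_deriv quad = 4 * (1 - 2 * fps_X)"
  by (simp add: quad_def algebra_simps)

text \<open>Since x(1-x) = w/4 and (1-2x)^2 = 1-w, the chain rule turns the equation with parameters
  A, B in x into four times the one with A/2, B/2 in w.\<close>

theorem gauss_quadratic_transformation:
  assumes "(A + B + 1) / 2 \<notin> \<int>\<^sub>\<le>\<^sub>0"
  shows "hyp2f1_fps (A / 2) (B / 2) ((A + B + 1) / 2) oo quad = hyp2f1_fps A B ((A + B + 1) / 2)"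
proof (rule fps_eq_hyp2f1_fps[OF assms])
  define E where "E = (A + B + 1) / 2"
  define f where "f = hyp2f1_fps (A / 2) (B / 2) E"
  define f0 f1 f2 where "f0 = f oo quad" and "f1 = fps_deriv f oo quad"
    and "f2 = fps_deriv (fps_deriv f) oo quad"
  have "fps_X * (1 - fps_X) * fps_deriv (fps_deriv f)
      + (fps_const E - fps_const (A / 2 + B / 2 + 1) * fps_X) * fps_deriv f
      = fps_const (A / 2 * (B / 2)) * f"
    unfolding hypergeometric_ode_iff f_def
    using hyp2f1_fps_recurrence[OF assms, folded E_def] by blast
  from arg_cong[OF this, of "\<lambda>g. g oo quad"]
  have ode: "quad * (1 - quad) * f2 + (fps_const E - fps_const (A / 2 + B / 2 + 1) * quad) * f1
      = fps_const (A / 2 * (B / 2)) * f0"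
    by (simp add: fps_compose_add_distrib fps_compose_sub_distrib fps_compose_mult_distrib
        f0_def f1_def f2_def)
  have d0: "fps_deriv f0 = f1 * (4 * (1 - 2 * fps_X))"
    by (simp add: f0_def f1_def fps_compose_deriv fps_deriv_quad)
  have "fps_deriv f1 = f2 * (4 * (1 - 2 * fps_X))"
    by (simp add: f1_def f2_def fps_compose_deriv fps_deriv_quad)
  moreover have "fps_deriv (fps_deriv f0) = fps_deriv f1 * (4 * (1 - 2 * fps_X)) - 8 * f1"
    unfolding d0 by (simp add: algebra_simps)
  ultimately have d1: "fps_deriv (fps_deriv f0) = f2 * (4 * (1 - 2 * fps_X))^2 - 8 * f1"
    by (simp only: power2_eq_square mult.assoc)
  define e p h where "e = fps_const E" and "p = fps_const (A / 2 * (B / 2))"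
    and "h = fps_const (1 / 2 :: complex)"
  have c: "fps_const (A / 2 + B / 2 + 1) = e + h"
    by (simp add: E_def e_def h_def add_divide_distrib)
  have h: "2 * h = 1"
    by (simp add: h_def numeral_fps_const)
  have c': "fps_const (A + B + 1) = 2 * e"
    by (simp add: E_def e_def numeral_fps_const)
  have p': "fps_const (A * B) = 4 * p"
    by (simp add: p_def numeral_fps_const)
  \<comment> \<open>A ring identity with \<open>e\<close>, \<open>h\<close>, \<open>p\<close> as
    indeterminates; the last summand corrects for \<open>h\<close> being 1/2.\<close>
  have "fps_X * (1 - fps_X) * (f2 * (4 * (1 - 2 * fps_X))^2 - 8 * f1)
      + (e - 2 * e * fps_X) * (f1 * (4 * (1 - 2 * fps_X))) - 4 * p * f0
    = 4 * (quad * (1 - quad) * f2 + (e - (e + h) * quad) * f1 - p * f0) + 2 * quad * f1 * (2 * h - 1)"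
    unfolding quad_def by (simp add: algebra_simps power2_eq_square)
  also have "\<dots> = 0"
    using ode h unfolding c e_def[symmetric] p_def[symmetric] by simp
  finally have diff: "fps_X * (1 - fps_X) * (f2 * (4 * (1 - 2 * fps_X))^2 - 8 * f1)
      + (e - 2 * e * fps_X) * (f1 * (4 * (1 - 2 * fps_X))) - 4 * p * f0 = 0" .
  have "fps_X * (1 - fps_X) * fps_deriv (fps_deriv f0)
      + (fps_const E - fps_const (A + B + 1) * fps_X) * fps_deriv f0 = fps_const (A * B) * f0"
    unfolding d1 unfolding d0 c' p' e_def[symmetric] by (rule eq_iff_diff_eq_0[THEN iffD2, OF diff])
  then have "\<forall>n. of_nat (Suc n) * (E + of_nat n) * fps_nth f0 (Suc n)
      = (A + of_nat n) * (B + of_nat n) * fps_nth f0 n"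
    unfolding hypergeometric_ode_iff .
  then show "of_nat (Suc n) * ((A + B + 1) / 2 + of_nat n)
          * fps_nth (hyp2f1_fps (A / 2) (B / 2) ((A + B + 1) / 2) oo quad) (Suc n)
      = (A + of_nat n) * (B + of_nat n)
          * fps_nth (hyp2f1_fps (A / 2) (B / 2) ((A + B + 1) / 2) oo quad) n" for n
    unfolding f0_def f_def E_def by blast
qed simp

section \<open>Powers of w and the moment functional\<close>

text \<open>The polynomial w^k = 4^k x^k (1-x)^k has lowest degree k and degree 2k; this keeps all
  later sums finite.\<close>

lemma quad_power_nth_eq_0:
  assumes "n < k \<or> 2 * k < n"
  shows "fps_nth (quad ^ k) n = 0"
proof -
  have "quad ^ k = fps_of_poly ([:0, 4, -4:] ^ k)"
    by (simp add: quad_def fps_of_poly_power fps_of_poly_pCons numeral_fps_const algebra_simps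
        flip: fps_const_neg)
  moreover have "degree ([:0, 4, -4 :: complex:] ^ k) \<le> 2 * k"
    by (rule order.trans[OF degree_power_le]) simp
  ultimately have "fps_nth (quad ^ k) n = 0" if "2 * k < n"
    using that by (simp add: coeff_eq_0)
  moreover have "fps_nth (quad ^ k) n = 0" if "n < k"
    using that by (simp add: startsby_zero_power_prefix)
  ultimately show ?thesis
    using assms by blast
qed

text \<open>The two lower parameters are kept independent so that the same expression, with halved
  ones, also gives the values of the functional on powers of \<open>quad\<close>.\<close>

definition moment :: "complex \<Rightarrow> complex \<Rightarrow> complex \<Rightarrow> nat \<Rightarrow> complex" where
  "moment C D D' n = fact n * pochhammer C n / (pochhammer D n * pochhammer D' n)"

lemma moment_Suc:
  assumes "D \<notin> \<int>\<^sub>\<le>\<^sub>0" "D' \<notin> \<int>\<^sub>\<le>\<^sub>0"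
  shows "(D + of_nat n) * (D' + of_nat n) * moment C D D' (Suc n)
       = of_nat (Suc n) * (C + of_nat n) * moment C D D' n"
  using pochhammer_nonzero[OF assms(1), of n] pochhammer_nonzero[OF assms(2), of n]
  by (simp add: moment_def pochhammer_Suc divide_simps)

text \<open>By the moment recurrence the sum telescopes, and the two conditions on \<open>g\<close>
  remove the boundary terms. A cutoff \<open>N\<close> replaces the infinite sum.\<close>

lemma moment_functional_annihilates:
  fixes g :: "complex fps"
  assumes D: "D \<notin> \<int>\<^sub>\<le>\<^sub>0" "D' \<notin> \<int>\<^sub>\<le>\<^sub>0" "D + D' = 1 + 2 * C"
    and g: "fps_nth g 0 = 0" "fps_nth g (Suc N) = 0"
  shows "(\<Sum>n\<le>N. moment C D D' n * fps_nth (fps_X * (1 - fps_X) * fps_deriv (fps_deriv g)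
           + fps_const C * (1 - 2 * fps_X) * fps_deriv g + fps_const (2 * C - D * D') * g) n) = 0"
    (is "(\<Sum>n\<le>N. _ * fps_nth ?h n) = 0")
proof -
  \<comment> \<open>The telescoping potential; the subtraction of 1 is complex, so
    \<open>n = 0\<close> causes no truncation.\<close>
  define t where
    "t n = moment C D D' n * (of_nat n - 1 + D) * (of_nat n - 1 + D') * fps_nth g n" for n
  have split: "?h = fps_X * fps_deriv (fps_deriv g) - fps_X * (fps_X * fps_deriv (fps_deriv g))
      + fps_const C * fps_deriv g - fps_const (2 * C) * (fps_X * fps_deriv g)
      + fps_const (2 * C - D * D') * g"
    by (simp add: algebra_simps numeral_fps_const flip: fps_const_mult)
  have D': "D' = 1 + 2 * C - D"
    using D(3) by (simp add: algebra_simps)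
  have nth: "fps_nth ?h n = of_nat (Suc n) * (C + of_nat n) * fps_nth g (Suc n)
      - (of_nat n - 1 + D) * (of_nat n - 1 + D') * fps_nth g n" for n
  proof -
    consider "n = 0" | "n = 1" | k where "n = Suc (Suc k)"
      by (metis One_nat_def not0_implies_Suc)
    then show ?thesis
      by cases (simp_all add: split, (simp_all add: D' algebra_simps)?)
  qed
  have "moment C D D' n * fps_nth ?h n = t (Suc n) - t n" for n
  proof -
    have "t (Suc n) = (D + of_nat n) * (D' + of_nat n) * moment C D D' (Suc n) * fps_nth g (Suc n)"
      by (simp add: t_def algebra_simps)
    also have "\<dots> = of_nat (Suc n) * (C + of_nat n) * moment C D D' n * fps_nth g (Suc n)"
      using moment_Suc[OF D(1,2)] by simp
    finally show ?thesis
      unfolding nth by (simp add: t_def algebra_simps)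
  qed
  then have "(\<Sum>n\<le>N. moment C D D' n * fps_nth ?h n) = (\<Sum>n\<le>N. t (Suc n) - t n)"
    by simp
  also have "\<dots> = t (Suc N) - t 0"
    unfolding lessThan_Suc_atMost[symmetric] by (rule sum_lessThan_telescope)
  also have "\<dots> = 0"
    using g by (simp add: t_def)
  finally show ?thesis .
qed

text \<open>The derivative of w squares to 16(1-w), so the result involves only w^k and
  w^(k-1).\<close>

lemma moment_functional_operator_quad_power:
  fixes C D D' :: complex and m :: nat
  assumes "D + D' = 1 + 2 * C"
  defines "k \<equiv> of_nat (Suc m) :: complex"
  shows "fps_X * (1 - fps_X) * fps_deriv (fps_deriv (quad ^ Suc m))
           + fps_const C * (1 - 2 * fps_X) * fps_deriv (quad ^ Suc m)
           + fps_const (2 * C - D * D') * quad ^ Suc m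
       = fps_const (4 * (k * (C + k - 1))) * quad ^ m
         - fps_const ((2 * k - 1 + D) * (2 * k - 1 + D')) * quad ^ Suc m"
proof -
  let ?K = "fps_const k"
  let ?C = "fps_const C" and ?D = "fps_const D" and ?D' = "fps_const D'"
  have d1: "fps_deriv (quad ^ Suc m) = ?K * (4 * (1 - 2 * fps_X)) * quad ^ m"
    unfolding fps_deriv_power fps_deriv_quad by (simp add: k_def del: power_Suc of_nat_Suc)
  \<comment> \<open>The factor \<open>quad\<close> avoids the exponent \<open>m - 1\<close>, so that
    \<open>m = 0\<close> is covered too.\<close>
  have d2: "quad * fps_deriv (quad ^ m) = (?K - 1) * (4 * (1 - 2 * fps_X)) * quad ^ m"
  proof -
    have "?K - 1 = of_nat m"
      by (simp add: k_def flip: fps_of_nat)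
    then show ?thesis
      unfolding fps_deriv_power fps_deriv_quad
      by (cases m) (simp_all add: fps_of_nat algebra_simps del: of_nat_Suc)
  qed
  have d3: "fps_deriv (?K * (4 * (1 - 2 * fps_X)) * quad ^ m)
      = ?K * (4 * (1 - 2 * fps_X)) * fps_deriv (quad ^ m) - 8 * ?K * quad ^ m"
    by (simp add: algebra_simps)
  have c: "fps_const (2 * C - D * D') = 2 * ?C - ?D * ?D'"
    "fps_const (4 * (k * (C + k - 1))) = 4 * (?K * (?C + ?K - 1))"
    "fps_const ((2 * k - 1 + D) * (2 * k - 1 + D')) = (2 * ?K - 1 + ?D) * (2 * ?K - 1 + ?D')"
    by (simp_all add: numeral_fps_const)
  have s: "?D + ?D' = 1 + 2 * ?C"
    using assms(1) by (simp add: numeral_fps_const)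
  define P P' where "P = quad ^ m" and "P' = fps_deriv (quad ^ m)"
  \<comment> \<open>The difference of the two sides is a combination of the relations
    \<open>d2\<close> and \<open>s\<close>, both of which amount to zero.\<close>
  have "fps_X * (1 - fps_X) * (?K * (4 * (1 - 2 * fps_X)) * P' - 8 * ?K * P)
      + ?C * (1 - 2 * fps_X) * (?K * (4 * (1 - 2 * fps_X)) * P) + (2 * ?C - ?D * ?D') * (quad * P)
      - (4 * (?K * (?C + ?K - 1)) * P - (2 * ?K - 1 + ?D) * (2 * ?K - 1 + ?D') * (quad * P))
    = ?K * (1 - 2 * fps_X) * (quad * P' - (?K - 1) * (4 * (1 - 2 * fps_X)) * P)
      + (2 * ?K - 1) * quad * P * (?D + ?D' - (1 + 2 * ?C))"
    unfolding quad_def by (simp add: algebra_simps del: fps_const_add fps_const_mult fps_const_sub)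
  also have "\<dots> = 0"
    using d2 s by (simp add: P_def P'_def del: fps_const_add)
  finally show ?thesis
    unfolding d1 unfolding d3 c power_Suc P_def P'_def by (rule eq_iff_diff_eq_0[THEN iffD2])
qed

text \<open>Annihilation gives a first-order recurrence in k, which is that of the moments with
  halved lower parameters. The bound on \<open>N\<close> lets the sum see all of w^k.\<close>

lemma moment_functional_quad_power:
  assumes D: "D \<notin> \<int>\<^sub>\<le>\<^sub>0" "D' \<notin> \<int>\<^sub>\<le>\<^sub>0" "D + D' = 1 + 2 * C"
    and D2: "(1 + D) / 2 \<notin> \<int>\<^sub>\<le>\<^sub>0" "(1 + D') / 2 \<notin> \<int>\<^sub>\<le>\<^sub>0"
    and "2 * k \<le> N"
  shows "(\<Sum>n\<le>N. moment C D D' n * fps_nth (quad ^ k) n) = moment C ((1 + D) / 2) ((1 + D') / 2) k"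
  using \<open>2 * k \<le> N\<close>
proof (induction k)
  case 0
  have "(\<Sum>n\<le>N. moment C D D' n * fps_nth (quad ^ 0) n) = (\<Sum>n\<in>{0}. moment C D D' n)"
    by (rule sum.mono_neutral_cong_right) auto
  then show ?case
    by (simp add: moment_def)
next
  case (Suc m)
  let ?L = "\<lambda>f. \<Sum>n\<le>N. moment C D D' n * fps_nth f n"
  define k :: complex where "k = of_nat (Suc m)"
  have lin: "?L (fps_const a * f - fps_const b * g) = a * ?L f - b * ?L g" for a b f g
    by (simp add: algebra_simps sum_subtractf sum_distrib_left)
  have "?L (fps_const (4 * (k * (C + k - 1))) * quad ^ m
         - fps_const ((2 * k - 1 + D) * (2 * k - 1 + D')) * quad ^ Suc m) = 0"
    unfolding k_def moment_functional_operator_quad_power[OF D(3), symmetric]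
    by (rule moment_functional_annihilates[OF D]) (use Suc.prems in \<open>auto intro!: quad_power_nth_eq_0 simp del: power_Suc\<close>)
  then have "4 * (k * (C + k - 1)) * ?L (quad ^ m)
      = (2 * k - 1 + D) * (2 * k - 1 + D') * ?L (quad ^ Suc m)"
    unfolding lin by simp
  \<comment> \<open>Division by 4, using 2k - 1 + D = 2((1+D)/2 + m) and likewise for
    \<open>D'\<close>.\<close>
  then have "((1 + D) / 2 + of_nat m) * ((1 + D') / 2 + of_nat m) * ?L (quad ^ Suc m)
      = of_nat (Suc m) * (C + of_nat m) * ?L (quad ^ m)"
    by (simp add: k_def field_simps del: power_Suc)
  also have "\<dots> = of_nat (Suc m) * (C + of_nat m) * moment C ((1 + D) / 2) ((1 + D') / 2) m"
    using Suc by simp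
  also have "\<dots> = ((1 + D) / 2 + of_nat m) * ((1 + D') / 2 + of_nat m)
      * moment C ((1 + D) / 2) ((1 + D') / 2) (Suc m)"
    by (rule moment_Suc[OF D2, symmetric])
  finally have "((1 + D) / 2 + of_nat m) * ((1 + D') / 2 + of_nat m) * ?L (quad ^ Suc m)
      = ((1 + D) / 2 + of_nat m) * ((1 + D') / 2 + of_nat m)
        * moment C ((1 + D) / 2) ((1 + D') / 2) (Suc m)" .
  moreover have "((1 + D) / 2 + of_nat m) * ((1 + D') / 2 + of_nat m) \<noteq> 0"
    using pochhammer_nonzero(2)[OF D2(1), of m] pochhammer_nonzero(2)[OF D2(2), of m]
    by (rule no_zero_divisors)
  ultimately show ?case
    by (rule mult_left_cancel[THEN iffD1, rotated])
qed

section \<open>Termination and interchange of summation\<close>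

lemma pochhammer_eventually_0:
  fixes a :: complex
  assumes "a \<in> \<int>\<^sub>\<le>\<^sub>0"
  obtains M where "\<And>n. n > M \<Longrightarrow> pochhammer a n = 0"
  using assms by (metis nonpos_Ints_cases' pochhammer_of_nat_eq_0_iff)

lemma hyp_at_one_conv_moment:
  "hyp_at_one [1, a, b, c] [e, d, d'] = (\<Sum>n. fps_nth (hyp2f1_fps a b e) n * moment c d d' n)"
  unfolding hyp_at_one_altdef
  by (intro suminf_cong) (simp add: moment_def pochhammer_fact)

text \<open>Applying the functional termwise swaps two sums; either a polynomial \<open>f\<close> or
  eventually vanishing moments make them finite.\<close>

lemma suminf_compose_quad:
  fixes f :: "complex fps" and l s :: "nat \<Rightarrow> complex"
  assumes s: "\<And>m N. 2 * m \<le> N \<Longrightarrow> (\<Sum>n\<le>N. l n * fps_nth (quad ^ m) n) = s m"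
    and fin: "(\<forall>n>M. fps_nth f n = 0) \<or> (\<forall>n>M. l n = 0)"
  shows "(\<Sum>n. fps_nth (f oo quad) n * l n) = (\<Sum>m. fps_nth f m * s m)"
proof -
  let ?N = "2 * M"
  have nth: "fps_nth (f oo quad) n = (\<Sum>m\<le>K. fps_nth f m * fps_nth (quad ^ m) n)" if "n \<le> K" for n K
    unfolding fps_compose_nth
    by (rule sum.mono_neutral_left) (use that in \<open>auto intro: quad_power_nth_eq_0\<close>)
  have s0: "s m = 0" if "m > M" "\<forall>n>M. l n = 0" for m
  proof -
    have "l n * fps_nth (quad ^ m) n = 0" for n
      using that quad_power_nth_eq_0[of n m] by (cases "n < m") auto
    then have "(\<Sum>n\<le>2 * m. l n * fps_nth (quad ^ m) n) = 0"
      by (intro sum.neutral ballI)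
    then show ?thesis
      using s[of m "2 * m"] by simp
  qed
  have term0: "fps_nth (f oo quad) n * l n = 0" if "n > ?N" for n
    using fin
  proof
    assume *: "\<forall>n>M. fps_nth f n = 0"
    have "fps_nth f m * fps_nth (quad ^ m) n = 0" for m
      using * that quad_power_nth_eq_0[of n m] by (cases "m > M") auto
    then have "fps_nth (f oo quad) n = 0"
      unfolding fps_compose_nth by (intro sum.neutral ballI)
    then show ?thesis
      by simp
  qed (use that in auto)
  \<comment> \<open>For \<open>m\<close> above \<open>M\<close> the cutoff \<open>?N\<close> is too
    small for assumption \<open>s\<close>. Then either the coefficient of \<open>f\<close> vanishes,
    or w^m starts beyond the last nonzero moment and both sums are zero.\<close>
  have inner: "fps_nth f m * (\<Sum>n\<le>?N. l n * fps_nth (quad ^ m) n) = fps_nth f m * s m" for m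
  proof (cases "m \<le> M")
    case False
    have "l n * fps_nth (quad ^ m) n = 0" if "\<forall>n>M. l n = 0" for n
      using that False quad_power_nth_eq_0[of n m] by (cases "n < m") auto
    then have "(\<Sum>n\<le>?N. l n * fps_nth (quad ^ m) n) = 0" if "\<forall>n>M. l n = 0"
      using that by (intro sum.neutral ballI)
    with False fin s0[of m] show ?thesis
      by auto
  qed (simp add: s)
  have "(\<Sum>n. fps_nth (f oo quad) n * l n) = (\<Sum>n\<le>?N. fps_nth (f oo quad) n * l n)"
    by (rule suminf_finite) (use term0 in auto)
  also have "\<dots> = (\<Sum>n\<le>?N. \<Sum>m\<le>?N. fps_nth f m * (l n * fps_nth (quad ^ m) n))"
    by (intro sum.cong refl) (simp add: nth[of _ ?N] sum_distrib_left algebra_simps)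
  also have "\<dots> = (\<Sum>m\<le>?N. fps_nth f m * s m)"
    by (subst sum.swap) (simp only: sum_distrib_left[symmetric] inner)
  also have "\<dots> = (\<Sum>m. fps_nth f m * s m)"
    by (rule suminf_finite[symmetric]) (use fin s0 in auto)
  finally show ?thesis .
qed

theorem mainTheorem10:
  fixes A B C D :: complex
  assumes "hyp_admissible [(A + B + 1) / 2, D, 1 + 2 * C - D]"
    and "hyp_admissible [(A + B + 1) / 2, (1 + D) / 2, 1 + C - D / 2]"
    and "hyp_terminates [1, A, B, C]"
    and "hyp_terminates [1, A / 2, B / 2, C]"
  shows "hyp_at_one [1, A, B, C] [(A + B + 1) / 2, D, 1 + 2 * C - D] =
         hyp_at_one [1, A / 2, B / 2, C] [(A + B + 1) / 2, (1 + D) / 2, 1 + C - D / 2]"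
proof -
  define D' where "D' = 1 + 2 * C - D"
  have D'2: "1 + C - D / 2 = (1 + D') / 2"
    by (simp add: D'_def field_simps)
  have E: "(A + B + 1) / 2 \<notin> \<int>\<^sub>\<le>\<^sub>0" and D: "D \<notin> \<int>\<^sub>\<le>\<^sub>0" "D' \<notin> \<int>\<^sub>\<le>\<^sub>0" "D + D' = 1 + 2 * C"
    and D2: "(1 + D) / 2 \<notin> \<int>\<^sub>\<le>\<^sub>0" "(1 + D') / 2 \<notin> \<int>\<^sub>\<le>\<^sub>0"
    using assms(1,2) unfolding D'2 by (auto simp: hyp_admissible_def D'_def)
  have "(1 :: complex) \<notin> \<int>\<^sub>\<le>\<^sub>0"
    by simp
  with assms(4) consider "A / 2 \<in> \<int>\<^sub>\<le>\<^sub>0" | "B / 2 \<in> \<int>\<^sub>\<le>\<^sub>0" | "C \<in> \<int>\<^sub>\<le>\<^sub>0"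
    by (auto simp: hyp_terminates_def)
  \<comment> \<open>A/2 or B/2 makes the series in w a polynomial, while C makes the moments vanish
    eventually.\<close>
  then obtain M where
    "(\<forall>n>M. fps_nth (hyp2f1_fps (A / 2) (B / 2) ((A + B + 1) / 2)) n = 0)
      \<or> (\<forall>n>M. moment C D D' n = 0)"
    by cases (erule pochhammer_eventually_0, fastforce simp: moment_def)+
  from suminf_compose_quad[OF moment_functional_quad_power[OF D D2] this]
  show ?thesis
    unfolding hyp_at_one_conv_moment gauss_quadratic_transformation[OF E] D'2 D'_def[symmetric] .
qed

end
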